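(* Let $V$ be a finite-dimensional vector space over $\mathbb{Q}$, let $h\in GL(V)$ and let $h=h_sh_u$ be its Chevalley (Jordan) decomposition, with $h_s$ semisimple, $h_u$ unipotent and $h_sh_u=h_uh_s$. Then $\mathrm{ht}(h)=\mathrm{ht}(h_s)$.
   Context: A lattice of $V$ is a finitely generated subgroup containing a basis of $V$. For $h\in GL(V)$, $\mathrm{ht}(h)$ is the minimum of $[\Lambda:E]$ over all pairs of lattices $E\subset\Lambda$ of $V$ with $h(E)\subset\Lambda$. *)

theory Defs
  imports "HOL-Analysis.Analysis"
begin

text \<open>V = Q^n, modelled as rat^'n; elements of GL(V) as invertible matrices acting by *v.\<close>

definition int_span :: "(rat^'n) set \<Rightarrow> (rat^'n) set" where
  "int_span S = {\<Sum>s\<in>S. of_int (c s) *s s | c. True}"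

definition is_lattice :: "(rat^'n) set \<Rightarrow> bool" where
  "is_lattice L \<longleftrightarrow>
     (\<exists>S. finite S \<and> L = int_span S) \<and>
     (\<exists>B\<subseteq>L. vec.independent B \<and> vec.span B = UNIV)"

definition lattice_index :: "(rat^'n) set \<Rightarrow> (rat^'n) set \<Rightarrow> nat" where
  "lattice_index \<Lambda> E = card ((\<lambda>x. (\<lambda>e. x + e) ` E) ` \<Lambda>)"

definition ht :: "rat^'n^'n \<Rightarrow> nat" where
  "ht h = (LEAST k. \<exists>E \<Lambda>. is_lattice E \<and> is_lattice \<Lambda> \<and> E \<subseteq> \<Lambda> \<and>
                         (\<lambda>x. h *v x) ` E \<subseteq> \<Lambda> \<and> k = lattice_index \<Lambda> E)"

definition cmat :: "rat^'n^'n \<Rightarrow> complex^'n^'n" where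
  "cmat A = (\<chi> i j. of_rat (A $ i $ j))"

text \<open>Semisimple: diagonalizable over an algebraically closed field (C) containing Q.\<close>
definition semisimple :: "rat^'n^'n \<Rightarrow> bool" where
  "semisimple A \<longleftrightarrow> (\<exists>P Q D :: complex^'n^'n. P ** Q = mat 1 \<and> Q ** P = mat 1 \<and>
      Q ** cmat A ** P = D \<and> (\<forall>i j. i \<noteq> j \<longrightarrow> D $ i $ j = 0))"

definition unipotent :: "rat^'n^'n \<Rightarrow> bool" where
  "unipotent A \<longleftrightarrow> (\<exists>k. ((\<lambda>X. X ** (A - mat 1)) ^^ k) (mat 1) = 0)"

end

(*
  If D is nilpotent and commutes with g, then ht (g + D) = ht g; the theorem is the case
  g = h_s, D = h_s (h_u - 1).

  Let E \<subseteq> \<Lambda> be lattices with g E \<subseteq> \<Lambda>, D^r = 0, and fix m > 0 with m D E \<subseteq> \<Lambda>, i.e.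
  m D E \<subseteq> (\<Lambda> \<inter> ker D^j) + m \<Lambda> for j = r. Replacing both lattices X by X' = (X \<inter> ker D^j) + m X
  keeps g E' \<subseteq> \<Lambda>' (g preserves ker D^j), turns the condition into the one for j - 1 (D maps
  ker D^j into ker D^(j-1)), and keeps the index: X / X' is isomorphic to P X / m P X for
  P = D^j, and this group has the same order for X = E and X = \<Lambda>, because P E \<subseteq> P \<Lambda> have
  finite index. At j = 0 the condition reads m D E \<subseteq> m \<Lambda>, so (g + D) E \<subseteq> \<Lambda>.
*)

theory Submission
  imports Defs
begin

section \<open>Additive subgroups and their cosets\<close>

definition add_subgroup :: "'a::ab_group_add set \<Rightarrow> bool" where
  "add_subgroup H \<longleftrightarrow> 0 \<in> H \<and> (\<forall>x\<in>H. \<forall>y\<in>H. x + y \<in> H) \<and> (\<forall>x\<in>H. - x \<in> H)"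

definition add_cosets :: "'a::plus set \<Rightarrow> 'a set \<Rightarrow> 'a set set" where
  "add_cosets G H = (\<lambda>x. (+) x ` H) ` G"

lemma add_subgroup_zero: "add_subgroup H \<Longrightarrow> 0 \<in> H"
  by (simp add: add_subgroup_def)

lemma add_subgroup_add: "add_subgroup H \<Longrightarrow> x \<in> H \<Longrightarrow> y \<in> H \<Longrightarrow> x + y \<in> H"
  by (simp add: add_subgroup_def)

lemma add_subgroup_uminus: "add_subgroup H \<Longrightarrow> x \<in> H \<Longrightarrow> - x \<in> H"
  by (simp add: add_subgroup_def)

lemma add_subgroup_diff: "add_subgroup H \<Longrightarrow> x \<in> H \<Longrightarrow> y \<in> H \<Longrightarrow> x - y \<in> H"
  by (metis add_subgroup_add add_subgroup_uminus diff_conv_add_uminus)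

lemma add_subgroup_sum:
  "add_subgroup H \<Longrightarrow> (\<And>i. i \<in> I \<Longrightarrow> f i \<in> H) \<Longrightarrow> sum f I \<in> H"
  by (induction I rule: infinite_finite_induct) (auto intro: add_subgroup_zero add_subgroup_add)

lemma add_subgroup_set_plus:
  assumes H: "add_subgroup H" and K: "add_subgroup K"
  shows "add_subgroup (H + K)"
  unfolding add_subgroup_def
proof (intro conjI ballI)
  show "0 \<in> H + K"
    using set_plus_intro[OF add_subgroup_zero[OF H] add_subgroup_zero[OF K]] by simp
next
  fix x y assume "x \<in> H + K" "y \<in> H + K"
  then obtain a b c d where "a \<in> H" "b \<in> K" "c \<in> H" "d \<in> K" "x = a + b" "y = c + d"
    by (meson set_plus_elim)
  moreover have "x + y = (a + c) + (b + d)" using calculation by (simp add: algebra_simps)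
  ultimately show "x + y \<in> H + K"
    using H K by (simp only:) (intro set_plus_intro add_subgroup_add)
next
  fix x assume "x \<in> H + K"
  then obtain a b where "a \<in> H" "b \<in> K" "x = a + b"
    by (meson set_plus_elim)
  moreover have "- x = - a + - b" using calculation by simp
  ultimately show "- x \<in> H + K"
    using H K by (simp only:) (intro set_plus_intro add_subgroup_uminus)
qed

lemma add_subgroup_Int: "add_subgroup H \<Longrightarrow> add_subgroup K \<Longrightarrow> add_subgroup (H \<inter> K)"
  unfolding add_subgroup_def by blast

lemma add_subgroup_image: "Modules.additive f \<Longrightarrow> add_subgroup H \<Longrightarrow> add_subgroup (f ` H)"
  unfolding add_subgroup_def
  by (auto simp flip: additive.add[of f] additive.minus[of f] intro!: image_eqI simp: additive.zero)

lemma add_subgroup_vimage: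
  "Modules.additive f \<Longrightarrow> add_subgroup H \<Longrightarrow> add_subgroup {x. f x \<in> H}"
  unfolding add_subgroup_def by (simp add: additive.add additive.minus additive.zero)

lemma add_subgroup_kernel: "Modules.additive f \<Longrightarrow> add_subgroup {x. f x = 0}"
  using add_subgroup_vimage[of f "{0}"] by (simp add: add_subgroup_def)

lemma coset_eq_iff:
  assumes "add_subgroup H"
  shows "(+) x ` H = (+) y ` H \<longleftrightarrow> x - y \<in> H"
proof
  assume "(+) x ` H = (+) y ` H"
  then have "x \<in> (+) y ` H"
    using add_subgroup_zero[OF assms] by (metis add.right_neutral imageI)
  then show "x - y \<in> H" by auto
next
  assume xy: "x - y \<in> H"
  show "(+) x ` H = (+) y ` H"
  proof (intro equalityI image_subsetI)
    fix h assume h: "h \<in> H"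
    have "x + h = y + ((x - y) + h)" by simp
    then show "x + h \<in> (+) y ` H"
      using add_subgroup_add[OF assms xy h] by (rule image_eqI)
    have "y + h = x + (- (x - y) + h)" by simp
    then show "y + h \<in> (+) x ` H"
      using add_subgroup_add[OF assms add_subgroup_uminus[OF assms xy] h] by (rule image_eqI)
  qed
qed

lemma finite_add_cosets:
  assumes "add_subgroup H" "finite R" "\<And>y. y \<in> G \<Longrightarrow> \<exists>r\<in>R. y - r \<in> H"
  shows "finite (add_cosets G H)"
proof (rule finite_subset)
  show "add_cosets G H \<subseteq> (\<lambda>r. (+) r ` H) ` R"
    unfolding add_cosets_def using assms(3) coset_eq_iff[OF assms(1)] by blast
qed (use assms(2) in simp)

lemma coset_set_plus:
  assumes "add_subgroup A" "add_subgroup B" "A \<subseteq> B"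
  shows "(+) x ` A + B = (+) x ` B"
proof -
  have "A + B = B"
    using assms add_subgroup_zero[OF assms(1)]
    by (force simp: set_plus_def intro: add_subgroup_add)
  then show ?thesis
    using set_plus_rearrange3[of x A B] by (simp add: elt_set_plus_def image_def)
qed

lemma add_cosets_set_plus:
  assumes "add_subgroup A" "add_subgroup B" "A \<subseteq> B"
  shows "add_cosets C B = (\<lambda>Z. Z + B) ` add_cosets C A"
  unfolding add_cosets_def by (simp add: image_image coset_set_plus[OF assms])

lemma card_add_cosets_tower:
  assumes A: "add_subgroup A" and B: "add_subgroup B" and C: "add_subgroup C"
    and "A \<subseteq> B" "B \<subseteq> C" and fin: "finite (add_cosets C A)"
  shows "card (add_cosets C A) = card (add_cosets C B) * card (add_cosets B A)"
proof -
  have CB: "add_cosets C B = (\<lambda>Z. Z + B) ` add_cosets C A"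
    by (rule add_cosets_set_plus[OF A B \<open>A \<subseteq> B\<close>])
  have fibre: "{Z \<in> add_cosets C A. Z + B = Y} = (\<lambda>Z. (+) y ` Z) ` add_cosets B A"
    if y: "y \<in> C" and Y: "Y = (+) y ` B" for y Y
  proof (intro equalityI subsetI)
    fix Z assume "Z \<in> {Z \<in> add_cosets C A. Z + B = Y}"
    then obtain c where c: "c \<in> C" "Z = (+) c ` A" "(+) c ` B = (+) y ` B"
      unfolding add_cosets_def using coset_set_plus[OF A B \<open>A \<subseteq> B\<close>] Y by auto
    then have "c - y \<in> B" using coset_eq_iff[OF B] by blast
    moreover have "Z = (+) y ` ((+) (c - y) ` A)" using c(2) by (simp add: image_image)
    ultimately show "Z \<in> (\<lambda>Z. (+) y ` Z) ` add_cosets B A"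
      unfolding add_cosets_def by blast
  next
    fix Z assume "Z \<in> (\<lambda>Z. (+) y ` Z) ` add_cosets B A"
    then obtain b where b: "b \<in> B" "Z = (+) (y + b) ` A"
      unfolding add_cosets_def by (auto simp: image_image add.assoc)
    have "y + b \<in> C" using add_subgroup_add[OF C y] b(1) \<open>B \<subseteq> C\<close> by blast
    moreover have "Z + B = Y"
      using b coset_set_plus[OF A B \<open>A \<subseteq> B\<close>] coset_eq_iff[OF B] Y by simp
    ultimately show "Z \<in> {Z \<in> add_cosets C A. Z + B = Y}"
      using b(2) unfolding add_cosets_def by blast
  qed
  have "card (add_cosets C A) = (\<Sum>Y\<in>add_cosets C B. card {Z \<in> add_cosets C A. Z + B = Y})"
    unfolding CB using sum.image_gen[OF fin, of "\<lambda>_. 1" "\<lambda>Z. Z + B"] by (simp only: card_eq_sum)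
  also have "\<dots> = (\<Sum>Y\<in>add_cosets C B. card (add_cosets B A))"
  proof (rule sum.cong)
    fix Y assume "Y \<in> add_cosets C B"
    then obtain y where "y \<in> C" "Y = (+) y ` B" unfolding add_cosets_def by blast
    have "inj ((`) ((+) y))"
      by (rule injI) (metis add_left_imp_eq image_inv_f_f inj_on_def)
    then show "card {Z \<in> add_cosets C A. Z + B = Y} = card (add_cosets B A)"
      unfolding fibre[OF \<open>y \<in> C\<close> \<open>Y = (+) y ` B\<close>]
      by (simp add: card_image inj_on_subset)
  qed simp
  finally show ?thesis by simp
qed

lemma image_coset:
  "Modules.additive f \<Longrightarrow> f ` ((+) x ` H) = (+) (f x) ` (f ` H)"
  by (simp add: image_image additive.add)

lemma card_add_cosets_image:
  assumes "Modules.additive f" "inj f"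
  shows "card (add_cosets (f ` G) (f ` H)) = card (add_cosets G H)"
proof -
  have "add_cosets (f ` G) (f ` H) = (`) f ` add_cosets G H"
    unfolding add_cosets_def by (simp add: image_image additive.add[OF assms(1)])
  moreover have "inj ((`) f)"
    using assms(2) by (meson injI inj_image_eq_iff)
  ultimately show ?thesis by (simp add: card_image inj_on_subset)
qed

lemma card_add_cosets_kernel:
  assumes p: "Modules.additive p" and L: "add_subgroup L" and M: "add_subgroup M" "M \<subseteq> L"
  shows "card (add_cosets L (L \<inter> {x. p x = 0} + M)) = card (add_cosets (p ` L) (p ` M))"
proof -
  define T where "T = L \<inter> {x. p x = 0} + M"
  have T: "add_subgroup T"
    unfolding T_def using L M add_subgroup_kernel[OF p]
    by (intro add_subgroup_set_plus add_subgroup_Int)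
  have pM: "add_subgroup (p ` M)" by (rule add_subgroup_image[OF p M(1)])
  have "p ` T = p ` M"
  proof (intro equalityI subsetI)
    fix z assume "z \<in> p ` T"
    then obtain a b where "a \<in> L \<inter> {x. p x = 0}" "b \<in> M" "z = p (a + b)"
      unfolding T_def by (auto elim: set_plus_elim)
    then show "z \<in> p ` M" by (simp add: additive.add[OF p])
  next
    fix z assume "z \<in> p ` M"
    then obtain b where "b \<in> M" "z = p (0 + b)" by auto
    moreover have "0 \<in> L \<inter> {x. p x = 0}" using add_subgroup_zero[OF L] additive.zero[OF p] by simp
    ultimately show "z \<in> p ` T" unfolding T_def by (blast intro: set_plus_intro)
  qed
  then have key: "p ` ((+) x ` T) = (+) (p x) ` (p ` M)" for x
    by (simp add: image_coset[OF p])
  have "inj_on ((`) p) (add_cosets L T)"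
  proof (rule inj_onI)
    fix Z1 Z2 assume "Z1 \<in> add_cosets L T" "Z2 \<in> add_cosets L T" "p ` Z1 = p ` Z2"
    then obtain x y where xy: "x \<in> L" "y \<in> L" "Z1 = (+) x ` T" "Z2 = (+) y ` T"
      and "(+) (p x) ` (p ` M) = (+) (p y) ` (p ` M)"
      unfolding add_cosets_def by (auto simp: key)
    then obtain b where b: "b \<in> M" "p x - p y = p b"
      using coset_eq_iff[OF pM] by auto
    have "x - y - b \<in> L \<inter> {x. p x = 0}"
      using b xy M(2) by (auto simp: additive.diff[OF p] intro!: add_subgroup_diff[OF L])
    then have "(x - y - b) + b \<in> T"
      unfolding T_def using b(1) by (rule set_plus_intro)
    then show "Z1 = Z2" using xy coset_eq_iff[OF T] by simp
  qed
  moreover have "(`) p ` add_cosets L T = add_cosets (p ` L) (p ` M)"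
  proof -
    have "(`) p ` add_cosets L T = (\<lambda>x. p ` ((+) x ` T)) ` L"
      unfolding add_cosets_def by (rule image_image)
    also have "\<dots> = (\<lambda>x. (+) (p x) ` (p ` M)) ` L"
      by (simp only: key)
    also have "\<dots> = add_cosets (p ` L) (p ` M)"
      unfolding add_cosets_def by (rule image_image[symmetric])
    finally show ?thesis .
  qed
  ultimately show ?thesis
    unfolding T_def[symmetric] by (metis card_image)
qed

text \<open>Compute the index of \<open>f ` H\<close> in \<open>G\<close> through \<open>H\<close> and through \<open>f ` G\<close>; the factor
  \<open>[f ` G : f ` H] = [G : H]\<close> cancels.\<close>

lemma card_add_cosets_endo_image_eq:
  assumes f: "Modules.additive f" "inj f" and G: "add_subgroup G" and H: "add_subgroup H" "H \<subseteq> G"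
    and "f ` G \<subseteq> G" "f ` H \<subseteq> H" and fin: "finite (add_cosets G (f ` H))"
  shows "card (add_cosets G (f ` G)) = card (add_cosets H (f ` H))"
proof -
  have fG: "add_subgroup (f ` G)" and fH: "add_subgroup (f ` H)"
    using add_subgroup_image[OF f(1)] G H by auto
  have "card (add_cosets G H) * card (add_cosets H (f ` H))
      = card (add_cosets G (f ` G)) * card (add_cosets (f ` G) (f ` H))"
    using card_add_cosets_tower[OF fH H(1) G \<open>f ` H \<subseteq> H\<close> H(2) fin]
      card_add_cosets_tower[OF fH fG G _ \<open>f ` G \<subseteq> G\<close> fin] H(2)
    by (metis image_mono)
  moreover have "card (add_cosets (f ` G) (f ` H)) = card (add_cosets G H)"
    by (rule card_add_cosets_image[OF f])
  moreover have "finite (add_cosets G H)"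
    using fin add_cosets_set_plus[OF fH H(1) \<open>f ` H \<subseteq> H\<close>] by (metis finite_imageI)
  then have "card (add_cosets G H) > 0"
    using add_subgroup_zero[OF G] by (auto simp: add_cosets_def card_gt_0_iff)
  ultimately show ?thesis by simp
qed

section \<open>Integer spans and lattices\<close>

lemma additive_matrix_vector_mult: "Modules.additive ((*v) A)"
  by standard (rule matrix_vector_right_distrib)

lemma additive_scale: "Modules.additive ((*s) (c :: 'a::ring))"
  by standard (simp add: vec_eq_iff distrib_left)

lemma additive_of_nat_scale:
  fixes f :: "'a::ring_1^'n \<Rightarrow> 'b::ring_1^'k"
  assumes "Modules.additive f"
  shows "f (of_nat m *s x) = of_nat m *s f x"
  by (induction m) (simp_all add: vector_sadd_rdistrib additive.add[OF assms] additive.zero[OF assms])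

lemma add_subgroup_of_nat_scale:
  fixes x :: "'a::ring_1^'n"
  shows "add_subgroup H \<Longrightarrow> x \<in> H \<Longrightarrow> of_nat n *s x \<in> H"
  by (induction n) (simp_all add: vector_sadd_rdistrib add_subgroup_zero add_subgroup_add)

lemma add_subgroup_of_int_scale:
  fixes x :: "'a::ring_1^'n"
  assumes "add_subgroup H" "x \<in> H"
  shows "of_int k *s x \<in> H"
proof -
  note nat = add_subgroup_of_nat_scale[OF assms]
  show ?thesis
  proof (cases k)
    case (neg n)
    then have "of_int k = - (of_nat (Suc n) :: 'a)" by simp
    then have "of_int k *s x = - (of_nat (Suc n) *s x)" by (simp only: vector_smult_lneg)
    then show ?thesis using add_subgroup_uminus[OF assms(1) nat] by (simp only:)
  qed (use nat in simp)
qed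

lemma mem_int_span: "x \<in> int_span S \<longleftrightarrow> (\<exists>c. x = (\<Sum>s\<in>S. of_int (c s) *s s))"
  by (simp add: int_span_def)

lemma add_subgroup_int_span: "add_subgroup (int_span S)"
  unfolding add_subgroup_def
proof (intro conjI ballI)
  show "0 \<in> int_span S"
    unfolding mem_int_span by (rule exI[of _ "\<lambda>_. 0"]) simp
next
  fix x y assume "x \<in> int_span S" "y \<in> int_span S"
  then obtain c d where "x = (\<Sum>s\<in>S. of_int (c s) *s s)" "y = (\<Sum>s\<in>S. of_int (d s) *s s)"
    unfolding mem_int_span by blast
  then show "x + y \<in> int_span S"
    unfolding mem_int_span
    by (intro exI[of _ "\<lambda>s. c s + d s"]) (simp add: sum.distrib vector_sadd_rdistrib)
next
  fix x assume "x \<in> int_span S"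
  then obtain c where "x = (\<Sum>s\<in>S. of_int (c s) *s s)"
    unfolding mem_int_span by blast
  then show "- x \<in> int_span S"
    unfolding mem_int_span by (intro exI[of _ "\<lambda>s. - c s"]) (simp add: sum_negf vector_smult_lneg)
qed

lemma int_span_base: "finite S \<Longrightarrow> S \<subseteq> int_span S"
proof
  fix s assume "finite S" "s \<in> S"
  have "(\<Sum>t\<in>S. of_int (if t = s then 1 else 0) *s t) = (\<Sum>t\<in>S. if t = s then t else 0)"
    by (rule sum.cong) auto
  also have "\<dots> = s" using \<open>finite S\<close> \<open>s \<in> S\<close> by simp
  finally show "s \<in> int_span S" unfolding mem_int_span by (metis (no_types))
qed

lemma int_span_least: "add_subgroup X \<Longrightarrow> S \<subseteq> X \<Longrightarrow> int_span S \<subseteq> X"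
  unfolding int_span_def
  by (auto intro!: add_subgroup_sum add_subgroup_of_int_scale)

lemma image_int_span_subset:
  assumes "Modules.additive f" "add_subgroup Y" "f ` S \<subseteq> Y"
  shows "f ` int_span S \<subseteq> Y"
  using int_span_least[OF add_subgroup_vimage[OF assms(1,2)]] assms(3) by blast

lemma image_int_span:
  assumes "finite S" "Modules.additive f"
  shows "f ` int_span S = int_span (f ` S)"
proof
  show "f ` int_span S \<subseteq> int_span (f ` S)"
    using assms by (intro image_int_span_subset add_subgroup_int_span int_span_base) auto
  show "int_span (f ` S) \<subseteq> f ` int_span S"
    using assms int_span_base[OF assms(1)]
    by (intro int_span_least add_subgroup_image add_subgroup_int_span) auto
qed

lemma int_span_mod_reps:
  assumes "finite S" "m > 0"
  obtains R where "finite R" "\<And>y. y \<in> int_span S \<Longrightarrow> \<exists>r\<in>R. y - r \<in> (*s) (of_nat m) ` int_span S"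
proof
  define R where "R = (\<lambda>d. \<Sum>s\<in>S. of_int (d s) *s s) ` (S \<rightarrow>\<^sub>E {0..<int m})"
  show "finite R" unfolding R_def using assms(1) by (intro finite_imageI finite_PiE) auto
  fix y assume "y \<in> int_span S"
  then obtain c where c: "y = (\<Sum>s\<in>S. of_int (c s) *s s)" unfolding mem_int_span by blast
  define r where "r = (\<Sum>s\<in>S. of_int (c s mod int m) *s s)"
  have "restrict (\<lambda>s. c s mod int m) S \<in> S \<rightarrow>\<^sub>E {0..<int m}" using assms(2) by auto
  moreover have "r = (\<Sum>s\<in>S. of_int (restrict (\<lambda>s. c s mod int m) S s) *s s)"
    unfolding r_def by (rule sum.cong) auto
  ultimately have "r \<in> R" unfolding R_def by blast
  have "of_int (c s) = of_nat m * of_int (c s div int m) + (of_int (c s mod int m) :: rat)" for s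
    by (metis div_mult_mod_eq mult.commute of_int_add of_int_mult of_int_of_nat_eq)
  then have "y - r = of_nat m *s (\<Sum>s\<in>S. of_int (c s div int m) *s s)"
    unfolding c r_def vec.scale_sum_right
    by (simp add: sum_subtractf[symmetric] vector_sadd_rdistrib)
  then have "y - r \<in> (*s) (of_nat m) ` int_span S"
    by (rule image_eqI) (auto simp: mem_int_span)
  with \<open>r \<in> R\<close> show "\<exists>r\<in>R. y - r \<in> (*s) (of_nat m) ` int_span S" by blast
qed

lemma finite_add_cosets_int_span:
  assumes "finite S" "add_subgroup X" "m > 0" "(*s) (of_nat m) ` int_span S \<subseteq> X"
  shows "finite (add_cosets (int_span S) X)"
proof -
  obtain R where "finite R" "\<And>y. y \<in> int_span S \<Longrightarrow> \<exists>r\<in>R. y - r \<in> (*s) (of_nat m) ` int_span S"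
    using int_span_mod_reps[OF assms(1,3)] by blast
  then show ?thesis using assms(4) by (intro finite_add_cosets[OF assms(2)]) blast+
qed

lemma add_subgroup_lattice: "is_lattice L \<Longrightarrow> add_subgroup L"
  unfolding is_lattice_def using add_subgroup_int_span by blast

lemma is_latticeI:
  assumes "finite S" "X \<subseteq> int_span S" "vec.span X = UNIV"
  shows "is_lattice (int_span S)"
proof -
  obtain B where "B \<subseteq> X" "vec.independent B" "X \<subseteq> vec.span B"
    by (rule vec.maximal_independent_subset)
  then have "vec.span B = UNIV"
    using assms(3) by (metis top.extremum_uniqueI vec.span_minimal vec.subspace_span)
  then show ?thesis
    unfolding is_lattice_def using assms(1,2) \<open>B \<subseteq> X\<close> \<open>vec.independent B\<close> by blast
qed

lemma lattice_scaled_mem: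
  assumes "is_lattice L"
  shows "\<exists>m>0. of_nat m *s v \<in> L"
proof -
  note L = add_subgroup_lattice[OF assms]
  define A where "A = {v. \<exists>m>0. of_nat m *s v \<in> L}"
  have "vec.subspace A"
    unfolding vec.subspace_def
  proof (intro conjI ballI allI)
    show "0 \<in> A" unfolding A_def using add_subgroup_zero[OF L] by (intro CollectI exI[of _ 1]) simp
  next
    fix x y assume "x \<in> A" "y \<in> A"
    then obtain m n where mn: "m > 0" "n > 0" and "of_nat m *s x \<in> L" "of_nat n *s y \<in> L"
      unfolding A_def by blast
    have "of_nat (m * n) *s (x + y) = of_nat n *s (of_nat m *s x) + of_nat m *s (of_nat n *s y)"
      by (simp add: vector_add_ldistrib mult.commute)
    also have "\<dots> \<in> L"
      using L \<open>of_nat m *s x \<in> L\<close> \<open>of_nat n *s y \<in> L\<close>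
      by (meson add_subgroup_add add_subgroup_of_nat_scale)
    finally show "x + y \<in> A"
      unfolding A_def using mn by (intro CollectI exI[of _ "m * n"]) simp
  next
    fix c :: rat and x assume "x \<in> A"
    then obtain m where "m > 0" "of_nat m *s x \<in> L" unfolding A_def by blast
    obtain a b where "quotient_of c = (a, b)" by (cases "quotient_of c")
    then have "b > 0" "c = of_int a / of_int b"
      by (simp_all add: quotient_of_denom_pos quotient_of_div)
    then have "of_nat (m * nat b) *s (c *s x) = of_int a *s (of_nat m *s x)"
      by (simp add: mult.commute)
    also have "\<dots> \<in> L" by (rule add_subgroup_of_int_scale[OF L \<open>of_nat m *s x \<in> L\<close>])
    finally show "c *s x \<in> A"
      unfolding A_def using \<open>m > 0\<close> \<open>b > 0\<close> by (intro CollectI exI[of _ "m * nat b"]) simp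
  qed
  moreover obtain B where "B \<subseteq> L" "vec.span B = UNIV"
    using assms unfolding is_lattice_def by blast
  moreover have "B \<subseteq> A" using \<open>B \<subseteq> L\<close> unfolding A_def by (auto intro!: exI[of _ 1])
  ultimately have "v \<in> A" using vec.span_minimal by blast
  then show ?thesis unfolding A_def by blast
qed

lemma lattice_scaled_subset:
  assumes "is_lattice L" "finite W"
  shows "\<exists>m>0. (*s) (of_nat m) ` W \<subseteq> L"
  using assms(2)
proof (induction W rule: finite_induct)
  case (insert w W)
  note scale = add_subgroup_of_nat_scale[OF add_subgroup_lattice[OF assms(1)]]
  obtain m where "m > 0" and m: "(*s) (of_nat m) ` W \<subseteq> L" using insert.IH by blast
  obtain n where "n > 0" and n: "of_nat n *s w \<in> L" using lattice_scaled_mem[OF assms(1)] by blast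
  have "of_nat (m * n) *s v \<in> L" if "v \<in> insert w W" for v
    using that
  proof
    assume "v = w"
    then show ?thesis using scale[OF n, of m] by (simp add: mult.commute)
  next
    assume "v \<in> W"
    then show ?thesis using scale[of "of_nat m *s v" n] m by (auto simp: mult.commute)
  qed
  then show ?case using \<open>m > 0\<close> \<open>n > 0\<close> by (intro exI[of _ "m * n"]) auto
qed auto

lemma lattice_scaled_int_span_subset:
  assumes "is_lattice L" "finite S"
  shows "\<exists>m>0. (*s) (of_nat m) ` int_span S \<subseteq> L"
  using lattice_scaled_subset[OF assms]
  by (meson additive_scale add_subgroup_lattice[OF assms(1)] image_int_span_subset)

lemma finite_add_cosets_lattices:
  assumes "is_lattice E" "is_lattice L"
  shows "finite (add_cosets L E)"
proof -
  obtain S where "finite S" "L = int_span S" using assms(2) unfolding is_lattice_def by blast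
  then show ?thesis
    using lattice_scaled_int_span_subset[OF assms(1)] add_subgroup_lattice[OF assms(1)]
    by (metis finite_add_cosets_int_span)
qed

lemma is_lattice_between:
  assumes E: "is_lattice E" and X: "add_subgroup X" and "m > 0"
    and mE: "(*s) (of_nat m) ` E \<subseteq> X" and "X \<subseteq> E"
  shows "is_lattice X"
proof -
  obtain S where S: "finite S" "E = int_span S" using E unfolding is_lattice_def by blast
  obtain R where "finite R" and R: "\<And>y. y \<in> E \<Longrightarrow> \<exists>r\<in>R. y - r \<in> (*s) (of_nat m) ` E"
    using int_span_mod_reps[OF S(1) \<open>m > 0\<close>] S(2) by blast
  define G where "G = (*s) (of_nat m) ` S \<union> (R \<inter> X)"
  have "finite G" unfolding G_def using S(1) \<open>finite R\<close> by simp
  have "X = int_span G"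
  proof
    have "G \<subseteq> X" unfolding G_def using mE int_span_base[OF S(1)] S(2) by blast
    then show "int_span G \<subseteq> X" by (rule int_span_least[OF X])
  next
    have mE_G: "(*s) (of_nat m) ` E \<subseteq> int_span G"
      unfolding S(2) using int_span_base[OF \<open>finite G\<close>]
      by (intro image_int_span_subset additive_scale add_subgroup_int_span) (auto simp: G_def)
    show "X \<subseteq> int_span G"
    proof
      fix x assume "x \<in> X"
      then obtain r where "r \<in> R" and xr: "x - r \<in> (*s) (of_nat m) ` E"
        using R \<open>X \<subseteq> E\<close> by blast
      then have "r \<in> X" using add_subgroup_diff[OF X \<open>x \<in> X\<close>, of "x - r"] mE by auto
      then have "r \<in> int_span G"
        using \<open>r \<in> R\<close> int_span_base[OF \<open>finite G\<close>] unfolding G_def by blast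
      then have "r + (x - r) \<in> int_span G"
        using mE_G xr by (blast intro: add_subgroup_add[OF add_subgroup_int_span])
      then show "x \<in> int_span G" by simp
    qed
  qed
  moreover obtain B where "B \<subseteq> E" "vec.span B = UNIV"
    using E unfolding is_lattice_def by blast
  moreover have "vec.span ((*s) (of_nat m) ` B) = UNIV"
  proof -
    have "b = inverse (of_nat m) *s (of_nat m *s b)" for b :: "rat^'n"
      using \<open>m > 0\<close> by simp
    then have "B \<subseteq> vec.span ((*s) (of_nat m) ` B)"
      by (metis image_subset_iff vec.span_base vec.span_scale subsetI imageI)
    then show ?thesis
      using \<open>vec.span B = UNIV\<close> by (metis top.extremum_uniqueI vec.span_minimal vec.subspace_span)
  qed
  ultimately show ?thesis
    using is_latticeI[OF \<open>finite G\<close>] mE by (metis image_mono order.trans)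
qed

section \<open>Refining a lattice along a subspace\<close>

definition refine_lattice :: "(rat^'n) set \<Rightarrow> nat \<Rightarrow> (rat^'n) set \<Rightarrow> (rat^'n) set" where
  "refine_lattice U m X = X \<inter> U + (*s) (of_nat m) ` X"

lemma add_subgroup_scaled:
  fixes X :: "('a::ring_1^'n) set"
  shows "add_subgroup X \<Longrightarrow> add_subgroup ((*s) (of_nat m) ` X)"
  by (rule add_subgroup_image[OF additive_scale])

lemma add_subgroup_refine_lattice:
  "add_subgroup X \<Longrightarrow> add_subgroup U \<Longrightarrow> add_subgroup (refine_lattice U m X)"
  unfolding refine_lattice_def
  by (intro add_subgroup_set_plus add_subgroup_Int add_subgroup_scaled)

lemma refine_lattice_subset: "add_subgroup X \<Longrightarrow> refine_lattice U m X \<subseteq> X"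
  unfolding refine_lattice_def
  by (auto elim!: set_plus_elim intro!: add_subgroup_add add_subgroup_of_nat_scale)

lemma scaled_subset_refine_lattice:
  assumes "add_subgroup X" "add_subgroup U"
  shows "(*s) (of_nat m) ` X \<subseteq> refine_lattice U m X"
proof
  fix y assume "y \<in> (*s) (of_nat m) ` X"
  then have "0 + y \<in> refine_lattice U m X"
    unfolding refine_lattice_def using assms by (intro set_plus_intro) (auto intro: add_subgroup_zero)
  then show "y \<in> refine_lattice U m X" by simp
qed

lemma refine_lattice_mono: "X \<subseteq> Y \<Longrightarrow> refine_lattice U m X \<subseteq> refine_lattice U m Y"
  unfolding refine_lattice_def by (intro set_plus_mono2 image_mono) auto

lemma is_lattice_refine_lattice:
  assumes "is_lattice X" "add_subgroup U" "m > 0"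
  shows "is_lattice (refine_lattice U m X)"
proof -
  note X = add_subgroup_lattice[OF assms(1)]
  show ?thesis
    by (rule is_lattice_between[OF assms(1) add_subgroup_refine_lattice[OF X assms(2)] assms(3)
          scaled_subset_refine_lattice[OF X assms(2)] refine_lattice_subset[OF X]])
qed

lemma image_refine_lattice_subset:
  assumes f: "Modules.additive f" and "f ` X \<subseteq> Y" "f ` U \<subseteq> V"
  shows "f ` refine_lattice U m X \<subseteq> refine_lattice V m Y"
proof
  fix z assume "z \<in> f ` refine_lattice U m X"
  then obtain a b where "a \<in> X \<inter> U" "b \<in> X" "z = f a + of_nat m *s f b"
    unfolding refine_lattice_def
    by (auto elim!: set_plus_elim simp: additive.add[OF f] additive_of_nat_scale[OF f])
  then show "z \<in> refine_lattice V m Y"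
    unfolding refine_lattice_def using assms(2,3) by (blast intro: set_plus_intro)
qed

lemma card_add_cosets_refine_lattice_image:
  fixes p :: "rat^'n \<Rightarrow> rat^'k"
  assumes p: "Modules.additive p" and L: "add_subgroup L"
  shows "card (add_cosets L (refine_lattice {x. p x = 0} m L))
       = card (add_cosets (p ` L) ((*s) (of_nat m) ` p ` L))"
proof -
  have "(*s) (of_nat m) ` L \<subseteq> L"
    using add_subgroup_of_nat_scale[OF L] by blast
  note kernel = card_add_cosets_kernel[OF p L add_subgroup_scaled[OF L] this]
  have "p ` (*s) (of_nat m) ` L = (*s) (of_nat m) ` p ` L"
    by (simp add: image_image additive_of_nat_scale[OF p])
  then show ?thesis
    using kernel unfolding refine_lattice_def by simp
qed

lemma card_add_cosets_scaled_image_eq: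
  fixes p :: "rat^'n \<Rightarrow> rat^'k"
  assumes p: "Modules.additive p" and E: "is_lattice E" and L: "is_lattice L" and "E \<subseteq> L"
    and "m > 0"
  shows "card (add_cosets (p ` L) ((*s) (of_nat m) ` p ` L))
       = card (add_cosets (p ` E) ((*s) (of_nat m) ` p ` E))"
proof (rule card_add_cosets_endo_image_eq[OF additive_scale])
  show "inj ((*s) (of_nat m :: rat) :: rat^'k \<Rightarrow> _)"
    using \<open>m > 0\<close> by (intro injI) (simp add: vec_eq_iff)
  show pL: "add_subgroup (p ` L)" and pE: "add_subgroup (p ` E)"
    using add_subgroup_image[OF p] add_subgroup_lattice E L by auto
  show "p ` E \<subseteq> p ` L" using \<open>E \<subseteq> L\<close> by (rule image_mono)
  show "(*s) (of_nat m) ` p ` L \<subseteq> p ` L" "(*s) (of_nat m) ` p ` E \<subseteq> p ` E"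
    using add_subgroup_of_nat_scale pL pE by blast+
  obtain S where S: "finite S" "L = int_span S" using L unfolding is_lattice_def by blast
  obtain d where "d > 0" and d: "(*s) (of_nat d) ` L \<subseteq> E"
    using lattice_scaled_int_span_subset[OF E S(1)] S(2) by blast
  have "(*s) (of_nat (m * d)) ` p ` L = (*s) (of_nat m) ` p ` (*s) (of_nat d) ` L"
    by (simp add: image_image additive_of_nat_scale[OF p] mult.commute)
  also have "\<dots> \<subseteq> (*s) (of_nat m) ` p ` E"
    using d by (intro image_mono)
  finally show "finite (add_cosets (p ` L) ((*s) (of_nat m) ` p ` E))"
    unfolding S(2) image_int_span[OF S(1) p] using \<open>m > 0\<close> \<open>d > 0\<close> S(1)
    by (intro finite_add_cosets_int_span[where m = "m * d"] add_subgroup_scaled[OF pE]) simp_all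
qed

lemma card_add_cosets_refine_lattice:
  fixes p :: "rat^'n \<Rightarrow> rat^'k"
  assumes p: "Modules.additive p" and E: "is_lattice E" and L: "is_lattice L" and "E \<subseteq> L"
    and "m > 0"
  defines "K \<equiv> {x. p x = 0}"
  shows "card (add_cosets (refine_lattice K m L) (refine_lattice K m E)) = card (add_cosets L E)"
proof -
  have K: "add_subgroup K" unfolding K_def by (rule add_subgroup_kernel[OF p])
  have "E \<noteq> {}" using add_subgroup_zero add_subgroup_lattice[OF E] by blast
  have lat: "is_lattice (refine_lattice K m E)" "is_lattice (refine_lattice K m L)"
    using is_lattice_refine_lattice[OF _ K \<open>m > 0\<close>] E L by auto
  note sub = add_subgroup_lattice[OF lat(1)] add_subgroup_lattice[OF E]
    add_subgroup_lattice[OF lat(2)] add_subgroup_lattice[OF L]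
  have fin: "finite (add_cosets L (refine_lattice K m E))"
    by (rule finite_add_cosets_lattices[OF lat(1) L])
  have "card (add_cosets L E) * card (add_cosets E (refine_lattice K m E))
      = card (add_cosets L (refine_lattice K m L))
          * card (add_cosets (refine_lattice K m L) (refine_lattice K m E))"
    using card_add_cosets_tower[OF sub(1,2,4) refine_lattice_subset[OF sub(2)] \<open>E \<subseteq> L\<close> fin]
      card_add_cosets_tower[OF sub(1,3,4) refine_lattice_mono[OF \<open>E \<subseteq> L\<close>]
        refine_lattice_subset[OF sub(4)] fin]
    by simp
  moreover have "card (add_cosets L (refine_lattice K m L)) = card (add_cosets E (refine_lattice K m E))"
    unfolding K_def card_add_cosets_refine_lattice_image[OF p sub(2)] card_add_cosets_refine_lattice_image[OF p sub(4)]
    by (rule card_add_cosets_scaled_image_eq[OF p E L \<open>E \<subseteq> L\<close> \<open>m > 0\<close>])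
  moreover have "card (add_cosets E (refine_lattice K m E)) > 0"
    using finite_add_cosets_lattices[OF lat(1) E] \<open>E \<noteq> {}\<close>
    by (simp add: add_cosets_def card_gt_0_iff)
  ultimately show ?thesis by simp
qed

lemma refine_lattice_UNIV:
  assumes "add_subgroup L"
  shows "refine_lattice UNIV m L = L"
proof
  show "refine_lattice UNIV m L \<subseteq> L" by (rule refine_lattice_subset[OF assms])
  show "L \<subseteq> refine_lattice UNIV m L"
  proof
    fix x assume "x \<in> L"
    then have "x + of_nat m *s 0 \<in> refine_lattice UNIV m L"
      unfolding refine_lattice_def using assms by (intro set_plus_intro imageI add_subgroup_zero) auto
    then show "x \<in> refine_lattice UNIV m L" by simp
  qed
qed

lemma refine_lattice_zero: "add_subgroup L \<Longrightarrow> refine_lattice {0} m L = (*s) (of_nat m) ` L"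
  unfolding refine_lattice_def by (simp add: Int_absorb1 add_subgroup_zero)

section \<open>Height under commuting nilpotent perturbations\<close>

lemma matrix_add_rdistrib: "(A + B) ** C = A ** C + B ** (C :: 'a::semiring_1^'n^'m)"
  by (simp add: matrix_matrix_mult_def vec_eq_iff sum.distrib distrib_right)

lemma matrix_mul_rzero: "A ** (0 :: 'a::semiring_1^'n^'m) = 0"
  by (simp add: matrix_matrix_mult_def vec_eq_iff)

primrec matpow :: "'a::semiring_1^'n^'n \<Rightarrow> nat \<Rightarrow> 'a^'n^'n" where
  "matpow A 0 = mat 1"
| "matpow A (Suc k) = matpow A k ** A"

lemma unipotent_iff_nilpotent:
  fixes A :: "rat^'n^'n"
  shows "unipotent A \<longleftrightarrow> (\<exists>k. matpow (A - mat 1) k = 0)"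
proof -
  have "((\<lambda>X. X ** B) ^^ k) (mat 1) = matpow B k" for B :: "rat^'n^'n" and k
    by (induction k) simp_all
  then show ?thesis unfolding unipotent_def by simp
qed

lemma matpow_commute:
  fixes A B :: "'a::semiring_1^'n^'n"
  assumes "B ** A = A ** B"
  shows "B ** matpow A k = matpow A k ** B"
proof (induction k)
  case (Suc k)
  have "B ** matpow A (Suc k) = (B ** matpow A k) ** A" by (simp add: matrix_mul_assoc)
  also have "\<dots> = matpow A k ** (B ** A)" by (simp add: Suc matrix_mul_assoc)
  also have "\<dots> = matpow A k ** (A ** B)" by (simp only: assms)
  also have "\<dots> = matpow A (Suc k) ** B" by (simp add: matrix_mul_assoc)
  finally show ?case .
qed simp

lemma matpow_mult_commuting:
  fixes A B :: "'a::semiring_1^'n^'n"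
  assumes "A ** B = B ** A"
  shows "matpow (A ** B) k = matpow A k ** matpow B k"
proof (induction k)
  case (Suc k)
  have "matpow (A ** B) (Suc k) = matpow A k ** (matpow B k ** A) ** B"
    by (simp add: Suc matrix_mul_assoc)
  also have "\<dots> = matpow A k ** (A ** matpow B k) ** B"
    by (simp only: matpow_commute[OF assms])
  also have "\<dots> = matpow A (Suc k) ** matpow B (Suc k)"
    by (simp add: matrix_mul_assoc)
  finally show ?case .
qed simp

lemma matrix_mul_lneg: "(- A) ** B = - (A ** (B :: 'a::ring_1^'n^'m))"
  by (simp add: matrix_matrix_mult_def vec_eq_iff sum_negf)

lemma matrix_mul_rneg: "A ** (- B) = - (A ** (B :: 'a::ring_1^'n^'m))"
  by (simp add: matrix_matrix_mult_def vec_eq_iff sum_negf)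

lemma matpow_uminus:
  fixes A :: "'a::ring_1^'n^'n"
  shows "matpow (- A) k = (if even k then matpow A k else - matpow A k)"
  by (induction k) (simp_all add: matrix_mul_rneg matrix_mul_lneg)

definition admissible_lattices :: "rat^'n^'n \<Rightarrow> (rat^'n) set \<Rightarrow> (rat^'n) set \<Rightarrow> bool" where
  "admissible_lattices h E \<Lambda> \<longleftrightarrow>
     is_lattice E \<and> is_lattice \<Lambda> \<and> E \<subseteq> \<Lambda> \<and> (\<lambda>x. h *v x) ` E \<subseteq> \<Lambda>"

lemma lattice_index_eq_card: "lattice_index \<Lambda> E = card (add_cosets \<Lambda> E)"
  by (simp add: lattice_index_def add_cosets_def)

lemma admissible_lattices_exist: "\<exists>E \<Lambda>. admissible_lattices h E \<Lambda>"
proof (intro exI)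
  define \<Lambda> where "\<Lambda> = int_span (cart_basis \<union> (\<lambda>x. h *v x) ` cart_basis)"
  have fin: "finite (cart_basis \<union> (\<lambda>x. h *v x) ` cart_basis)"
    by (simp add: vec.finite_Basis)
  then have gens: "cart_basis \<union> (\<lambda>x. h *v x) ` cart_basis \<subseteq> \<Lambda>"
    unfolding \<Lambda>_def by (rule int_span_base)
  show "admissible_lattices h (int_span cart_basis) \<Lambda>"
    unfolding admissible_lattices_def
  proof (intro conjI)
    show "is_lattice (int_span cart_basis)"
      by (rule is_latticeI[OF vec.finite_Basis int_span_base[OF vec.finite_Basis] vec.span_Basis])
    show "is_lattice \<Lambda>"
      unfolding \<Lambda>_def using gens vec.span_Basis
      by (intro is_latticeI[OF fin, of cart_basis]) (auto simp: \<Lambda>_def)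
    show "int_span cart_basis \<subseteq> \<Lambda>"
      using gens by (intro int_span_least) (auto simp: \<Lambda>_def add_subgroup_int_span)
    show "(\<lambda>x. h *v x) ` int_span cart_basis \<subseteq> \<Lambda>"
      using gens by (intro image_int_span_subset additive_matrix_vector_mult) (auto simp: \<Lambda>_def add_subgroup_int_span)
  qed
qed

lemma ht_eq_Least_admissible:
  "ht h = (LEAST k. \<exists>E \<Lambda>. admissible_lattices h E \<Lambda> \<and> k = lattice_index \<Lambda> E)"
  by (simp add: ht_def admissible_lattices_def conj_assoc)

lemma ht_attained: "\<exists>E \<Lambda>. admissible_lattices h E \<Lambda> \<and> ht h = lattice_index \<Lambda> E"
proof -
  have "\<exists>k E \<Lambda>. admissible_lattices h E \<Lambda> \<and> k = lattice_index \<Lambda> E"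
    using admissible_lattices_exist by blast
  from LeastI_ex[OF this] show ?thesis unfolding ht_eq_Least_admissible .
qed

lemma ht_le: "admissible_lattices h E \<Lambda> \<Longrightarrow> ht h \<le> lattice_index \<Lambda> E"
  unfolding ht_eq_Least_admissible by (rule Least_le) blast

lemma admissible_lattices_add_nilpotent:
  fixes g D :: "rat^'n^'n"
  assumes "g ** D = D ** g" "m > 0"
  shows "admissible_lattices g E \<Lambda> \<Longrightarrow>
    (\<lambda>x. of_nat m *s (D *v x)) ` E \<subseteq> refine_lattice {x. matpow D k *v x = 0} m \<Lambda> \<Longrightarrow>
    \<exists>E' \<Lambda>'. admissible_lattices (g + D) E' \<Lambda>' \<and> lattice_index \<Lambda>' E' = lattice_index \<Lambda> E"
proof (induction k arbitrary: E \<Lambda>)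
  case 0
  then have \<Lambda>: "add_subgroup \<Lambda>" and g: "(\<lambda>x. g *v x) ` E \<subseteq> \<Lambda>"
    by (auto simp: admissible_lattices_def add_subgroup_lattice)
  have "D *v x \<in> \<Lambda>" if "x \<in> E" for x
  proof -
    have "of_nat m *s (D *v x) \<in> (*s) (of_nat m) ` \<Lambda>"
      using "0.prems"(2) that refine_lattice_zero[OF \<Lambda>] by auto
    then obtain y where "y \<in> \<Lambda>" "of_nat m *s (D *v x) = of_nat m *s y" by blast
    moreover from this(2) have "D *v x = y" using \<open>m > 0\<close> by (simp add: vec_eq_iff)
    ultimately show ?thesis by simp
  qed
  then have "(\<lambda>x. (g + D) *v x) ` E \<subseteq> \<Lambda>"
    using g by (auto simp: matrix_vector_mult_add_rdistrib intro: add_subgroup_add[OF \<Lambda>])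
  then show ?case using "0.prems"(1) unfolding admissible_lattices_def by blast
next
  case (Suc k)
  define U where "U = {x. matpow D (Suc k) *v x = 0}"
  have mD: "Modules.additive (\<lambda>x. of_nat m *s (D *v x))"
    by standard (simp add: matrix_vector_right_distrib vector_add_ldistrib)
  have U: "add_subgroup U"
    unfolding U_def by (rule add_subgroup_kernel[OF additive_matrix_vector_mult])
  have gU: "(\<lambda>x. g *v x) ` U \<subseteq> U"
  proof (rule image_subsetI)
    fix x assume "x \<in> U"
    have "matpow D (Suc k) *v (g *v x) = g *v (matpow D (Suc k) *v x)"
      unfolding matrix_vector_mul_assoc matpow_commute[OF assms(1)] ..
    then show "g *v x \<in> U" using \<open>x \<in> U\<close> unfolding U_def by simp
  qed
  have DU: "(\<lambda>x. of_nat m *s (D *v x)) ` U \<subseteq> {x. matpow D k *v x = 0}"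
    unfolding U_def by (auto simp: vector_scalar_commute matrix_vector_mul_assoc)
  note adm = Suc.prems(1)[unfolded admissible_lattices_def]
  have "(\<lambda>x. g *v x) ` refine_lattice U m E \<subseteq> refine_lattice U m \<Lambda>"
    using adm gU by (intro image_refine_lattice_subset[OF additive_matrix_vector_mult]) auto
  then have "admissible_lattices g (refine_lattice U m E) (refine_lattice U m \<Lambda>)"
    using adm is_lattice_refine_lattice[OF _ U \<open>m > 0\<close>] refine_lattice_mono
    unfolding admissible_lattices_def by blast
  moreover have "(\<lambda>x. of_nat m *s (D *v x)) ` refine_lattice U m E \<subseteq>
           refine_lattice {x. matpow D k *v x = 0} m (refine_lattice U m \<Lambda>)"
    using Suc.prems(2) DU unfolding U_def[symmetric] by (rule image_refine_lattice_subset[OF mD])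
  ultimately obtain E' \<Lambda>' where "admissible_lattices (g + D) E' \<Lambda>'"
    "lattice_index \<Lambda>' E' = lattice_index (refine_lattice U m \<Lambda>) (refine_lattice U m E)"
    using Suc.IH by blast
  moreover have "lattice_index (refine_lattice U m \<Lambda>) (refine_lattice U m E) = lattice_index \<Lambda> E"
    unfolding lattice_index_eq_card U_def using adm \<open>m > 0\<close>
    by (intro card_add_cosets_refine_lattice[OF additive_matrix_vector_mult]) auto
  ultimately show ?case by auto
qed

lemma ht_add_nilpotent_le:
  fixes g D :: "rat^'n^'n"
  assumes "g ** D = D ** g" "matpow D r = 0"
  shows "ht (g + D) \<le> ht g"
proof -
  obtain E \<Lambda> where adm: "admissible_lattices g E \<Lambda>" and ht: "ht g = lattice_index \<Lambda> E"
    using ht_attained by blast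
  then obtain S where S: "finite S" "E = int_span S"
    unfolding admissible_lattices_def is_lattice_def by blast
  then have "(\<lambda>x. D *v x) ` E = int_span ((\<lambda>x. D *v x) ` S)"
    using image_int_span[OF S(1) additive_matrix_vector_mult] by simp
  then obtain m where "m > 0" and "(*s) (of_nat m) ` (\<lambda>x. D *v x) ` E \<subseteq> \<Lambda>"
    using lattice_scaled_int_span_subset[of \<Lambda> "(\<lambda>x. D *v x) ` S"] adm S(1)
    unfolding admissible_lattices_def by auto
  then have "(\<lambda>x. of_nat m *s (D *v x)) ` E \<subseteq> refine_lattice {x. matpow D r *v x = 0} m \<Lambda>"
    using adm refine_lattice_UNIV[of \<Lambda> m]
    by (simp add: assms(2) image_image admissible_lattices_def add_subgroup_lattice)
  then obtain E' \<Lambda>' where "admissible_lattices (g + D) E' \<Lambda>'" "lattice_index \<Lambda>' E' = lattice_index \<Lambda> E"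
    using admissible_lattices_add_nilpotent[OF assms(1) \<open>m > 0\<close> adm] by blast
  then show ?thesis using ht_le[of "g + D" E' \<Lambda>'] ht by simp
qed

lemma ht_add_nilpotent:
  fixes g D :: "rat^'n^'n"
  assumes "g ** D = D ** g" "matpow D r = 0"
  shows "ht (g + D) = ht g"
proof (rule antisym)
  show "ht (g + D) \<le> ht g" by (rule ht_add_nilpotent_le[OF assms])
  have "(g + D) ** (- D) = (- D) ** (g + D)"
    by (simp add: matrix_mul_lneg matrix_mul_rneg matrix_add_ldistrib matrix_add_rdistrib assms(1))
  moreover have "matpow (- D) r = 0" by (simp add: matpow_uminus assms(2))
  ultimately have "ht (g + D + - D) \<le> ht (g + D)" by (rule ht_add_nilpotent_le)
  then show "ht g \<le> ht (g + D)" by simp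
qed

theorem lemma13:
  fixes h hs hu :: "rat^'n^'n"
  assumes "invertible h"
    and "h = hs ** hu"
    and "hs ** hu = hu ** hs"
    and "semisimple hs"
    and "unipotent hu"
  shows "ht h = ht hs"
proof -
  define N where "N = hu - mat 1"
  obtain k where "matpow N k = 0"
    using assms(5) unfolding unipotent_iff_nilpotent N_def by blast
  have hu: "hu = mat 1 + N" unfolding N_def by simp
  have "hs ** N = N ** hs"
    using assms(3) unfolding hu by (simp add: matrix_add_ldistrib matrix_add_rdistrib)
  then have "hs ** (hs ** N) = (hs ** N) ** hs" and "matpow (hs ** N) k = 0"
    using \<open>matpow N k = 0\<close> by (simp_all add: matrix_mul_assoc matpow_mult_commuting matrix_mul_rzero)
  moreover have "h = hs + hs ** N"
    using assms(2) unfolding hu by (simp add: matrix_add_ldistrib)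
  ultimately show ?thesis using ht_add_nilpotent by blast
qed

end
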